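(* There exists no profitable increasing reward program. That is, there is no increasing function $\hat r:\mathbb{R}\to[0,p]$ and cutoff $c\in\mathbb{R}$ such that the threshold strategy "consumer $i$ buys iff $v_i>c$" is an equilibrium, i.e. $$\mathbb{E}_{v|v_i}[\hat r(v)]+v_i-p\ge 0\ \text{ for all } v_i\ge c,\qquad \mathbb{E}_{v|v_i}[\hat r(v)]+v_i-p\le 0\ \text{ for all } v_i\le c,$$ and the resulting expected profit exceeds that of the no-reward case, i.e. $$\mathbb{E}_v\Big[(p-\hat r(v))\,\Phi\Big(\frac{v-c}{\sigma_\epsilon}\Big)\Big]>p\,\Phi\Big(\frac{\theta-p}{\sigma}\Big).$$
   Context: Parameters: $\theta\in\mathbb{R}$, $\sigma_\theta>0$, $\sigma_\epsilon>0$, $\sigma=\sqrt{\sigma_\theta^2+\sigma_\epsilon^2}$. $\Phi$ and $\phi$ are the CDF and PDF of the standard normal distribution. The quality $v$ of a product has prior $v\sim N(\theta,\sigma_\theta^2)$; $\mathbb{E}_v$ is expectation under this prior. Consumers $i\in[0,1]$ have valuations $v_i=v+\epsilon_i$ with $\epsilon_i\sim N(0,\sigma_\epsilon^2)$ independent of $v$, so that $v\,|\,v_i\sim N(\tau v_i+(1-\tau)\theta,\sigma_v^2)$ with $\tau=\frac{\sigma_\theta^2}{\sigma_\epsilon^2+\sigma_\theta^2}$ and $\sigma_v^2=\frac{\sigma_\epsilon^2\sigma_\theta^2}{\sigma_\epsilon^2+\sigma_\theta^2}$; $\mathbb{E}_{v|v_i}$ is expectation under this posterior. Standing assumption: the market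 price $p>0$ maximizes $p\mapsto p\,\Phi(\frac{\theta-p}{\sigma})$, i.e. it is the unique solution of $\frac{p}{\sigma}=\Phi(\frac{\theta-p}{\sigma})/\phi(\frac{\theta-p}{\sigma})$. A reward program pays each buyer a rebate $r(\bar a)\in[0,p]$ depending on the sales volume $\bar a$. When consumers buy iff $v_i>c$, the sales volume at quality $v$ is $\bar a=\Phi(\frac{v-c}{\sigma_\epsilon})$, a strictly increasing function of $v$, so the program is represented by $\hat r(v)=r(\Phi(\frac{v-c}{\sigma_\epsilon}))$ and "increasing" in sales volume is the same as increasing in $v$. A reward program is profitable if it yields an expected profit strictly higher than the no-reward profit $p\,\Phi(\frac{\theta-p}{\sigma})$. *)

theory Defs
  imports "HOL-Probability.Probability"
begin

definition Phi :: "real \<Rightarrow> real" where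
  "Phi = cdf std_normal_distribution"

text \<open>The second argument of \<^const>\<open>normal_density\<close> is the standard deviation, not the variance.\<close>

definition normal_distribution :: "real \<Rightarrow> real \<Rightarrow> real measure" where
  "normal_distribution \<mu> s = density lborel (normal_density \<mu> s)"

definition total_sd :: "real \<Rightarrow> real \<Rightarrow> real" where
  "total_sd s_theta s_eps = sqrt (s_theta\<^sup>2 + s_eps\<^sup>2)"

definition prior :: "real \<Rightarrow> real \<Rightarrow> real measure" where
  "prior \<theta> s_theta = normal_distribution \<theta> s_theta"

definition tau :: "real \<Rightarrow> real \<Rightarrow> real" where
  "tau s_theta s_eps = s_theta\<^sup>2 / (s_eps\<^sup>2 + s_theta\<^sup>2)"

definition posterior_sd :: "real \<Rightarrow> real \<Rightarrow> real" where
  "posterior_sd s_theta s_eps = sqrt (s_eps\<^sup>2 * s_theta\<^sup>2 / (s_eps\<^sup>2 + s_theta\<^sup>2))"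

text \<open>Law of the quality \<open>v\<close> given the valuation \<open>x = v + \<epsilon>\<close>, where \<open>v\<close> has law
  \<open>prior \<theta> s_theta\<close> and \<open>\<epsilon>\<close> is independent centred normal noise with standard deviation \<open>s_eps\<close>.\<close>

definition posterior :: "real \<Rightarrow> real \<Rightarrow> real \<Rightarrow> real \<Rightarrow> real measure" where
  "posterior \<theta> s_theta s_eps x =
     normal_distribution (tau s_theta s_eps * x + (1 - tau s_theta s_eps) * \<theta>)
       (posterior_sd s_theta s_eps)"

definition no_reward_profit :: "real \<Rightarrow> real \<Rightarrow> real \<Rightarrow> real \<Rightarrow> real" where
  "no_reward_profit \<theta> s_theta s_eps p = p * Phi ((\<theta> - p) / total_sd s_theta s_eps)"

definition market_price :: "real \<Rightarrow> real \<Rightarrow> real \<Rightarrow> real \<Rightarrow> bool" where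
  "market_price \<theta> s_theta s_eps p \<longleftrightarrow>
     p > 0 \<and>
     (\<forall>q>0. no_reward_profit \<theta> s_theta s_eps q \<le> no_reward_profit \<theta> s_theta s_eps p)"

text \<open>A reward program is given by the rebate \<open>r v\<close> as a function of the quality \<open>v\<close>. When
  consumers buy iff their valuation exceeds \<open>c\<close>, the sales volume \<open>Phi ((v - c) / s_eps)\<close> is
  strictly increasing in \<open>v\<close>, so this is equivalent to a rebate depending on the sales volume,
  with the same monotonicity.\<close>

definition increasing_reward_program :: "real \<Rightarrow> (real \<Rightarrow> real) \<Rightarrow> bool" where
  "increasing_reward_program p r \<longleftrightarrow> mono r \<and> (\<forall>v. r v \<in> {0..p})"

definition buyer_payoff ::
  "real \<Rightarrow> real \<Rightarrow> real \<Rightarrow> real \<Rightarrow> (real \<Rightarrow> real) \<Rightarrow> real \<Rightarrow> real" where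
  "buyer_payoff \<theta> s_theta s_eps p r x = (\<integral>v. r v \<partial>posterior \<theta> s_theta s_eps x) + x - p"

definition threshold_equilibrium ::
  "real \<Rightarrow> real \<Rightarrow> real \<Rightarrow> real \<Rightarrow> (real \<Rightarrow> real) \<Rightarrow> real \<Rightarrow> bool" where
  "threshold_equilibrium \<theta> s_theta s_eps p r c \<longleftrightarrow>
     (\<forall>x\<ge>c. buyer_payoff \<theta> s_theta s_eps p r x \<ge> 0) \<and>
     (\<forall>x\<le>c. buyer_payoff \<theta> s_theta s_eps p r x \<le> 0)"

definition reward_profit ::
  "real \<Rightarrow> real \<Rightarrow> real \<Rightarrow> real \<Rightarrow> (real \<Rightarrow> real) \<Rightarrow> real \<Rightarrow> real" where
  "reward_profit \<theta> s_theta s_eps p r c =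
     (\<integral>v. (p - r v) * Phi ((v - c) / s_eps) \<partial>prior \<theta> s_theta)"

end

theory Submission
  imports Defs
begin

text \<open>Since \<open>r\<close> is increasing and the posterior of \<open>v\<close> given the valuation \<open>x\<close> shifts to the
  right as \<open>x\<close> grows, a buyer with valuation \<open>x \<ge> c\<close> leaves the seller at most the expected margin
  \<open>E[p - r(v) | x = c]\<close>. The indifference condition at the cutoff says that this margin is
  exactly \<open>c\<close>. Hence the profit is at most the no-reward profit at the price \<open>c\<close>, which cannot
  beat the market price.\<close>

lemma prob_space_normal_distribution:
  assumes "s > 0"
  shows "prob_space (normal_distribution m s)"
  unfolding normal_distribution_def using assms by (rule prob_space_normal_density)

lemma space_normal_distribution [simp]: "space (normal_distribution m s) = UNIV"
  by (simp add: normal_distribution_def)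

lemma sets_normal_distribution [simp, measurable_cong]: "sets (normal_distribution m s) = sets borel"
  by (simp add: normal_distribution_def)

lemma nn_integral_normal_distribution:
  assumes [measurable]: "f \<in> borel_measurable borel"
  shows "(\<integral>\<^sup>+v. f v \<partial>normal_distribution m s) = (\<integral>\<^sup>+v. ennreal (normal_density m s v) * f v \<partial>lborel)"
  unfolding normal_distribution_def by (simp add: nn_integral_density)

text \<open>Translation moves the mean into the integrand, so that normal laws with different means
  become integrals over one centred law.\<close>

lemma nn_integral_normal_distribution_shift:
  assumes [measurable]: "f \<in> borel_measurable borel"
  shows "(\<integral>\<^sup>+v. f v \<partial>normal_distribution m s) = (\<integral>\<^sup>+v. f (m + v) \<partial>normal_distribution 0 s)"
proof -
  have "(\<integral>\<^sup>+v. f v \<partial>normal_distribution m s) =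
      (\<integral>\<^sup>+v. ennreal (normal_density m s (m + 1 * v)) * f (m + 1 * v) \<partial>lborel)"
    by (subst nn_integral_normal_distribution, simp, subst nn_integral_real_affine[where c = 1 and t = m])
      simp_all
  also have "\<dots> = (\<integral>\<^sup>+v. f (m + v) \<partial>normal_distribution 0 s)"
    by (subst nn_integral_normal_distribution) (simp_all add: normal_density_def)
  finally show ?thesis .
qed

text \<open>First-order stochastic dominance by coupling: after centring, both sides integrate over
  the same law and the integrands compare pointwise, since
  \<open>m + v \<le> m' + v\<close>.\<close>

lemma nn_integral_normal_distribution_antimono_mean:
  assumes "antimono f" and f [measurable]: "f \<in> borel_measurable borel" and "m \<le> m'"
  shows "(\<integral>\<^sup>+v. f v \<partial>normal_distribution m' s) \<le> (\<integral>\<^sup>+v. f v \<partial>normal_distribution m s)"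
  unfolding nn_integral_normal_distribution_shift[OF f, of m]
    nn_integral_normal_distribution_shift[OF f, of m']
  using assms(3) by (intro nn_integral_mono antimonoD[OF assms(1)]) simp

lemma Phi_nonneg: "0 \<le> Phi x"
  by (simp add: Phi_def cdf_def)

lemma borel_measurable_Phi [measurable]: "Phi \<in> borel_measurable borel"
proof (rule borel_measurable_mono)
  interpret real_distribution std_normal_distribution
    by (rule real_dist_normal_dist)
  show "mono Phi"
    by (auto simp: Phi_def mono_def cdf_nondecreasing)
qed

text \<open>This reads \<open>Phi\<close> as a purchase probability: with mean \<open>v\<close> and
  deviation \<open>s_eps\<close> it is the chance that the valuation reaches \<open>c\<close> given
  quality \<open>v\<close>; with mean \<open>\<theta>\<close> and deviation
  \<open>total_sd s_theta s_eps\<close> it is the demand at price \<open>c\<close>.\<close>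

lemma emeasure_normal_distribution_atLeast:
  assumes "s > 0"
  shows "emeasure (normal_distribution m s) {c..} = ennreal (Phi ((m - c) / s))"
proof -
  interpret prob_space std_normal_distribution
    by (rule prob_space_normal_density) simp
  have "emeasure (normal_distribution m s) {c..} =
      (\<integral>\<^sup>+x. ennreal (normal_density m s x) * indicator {c..} x \<partial>lborel)"
    unfolding normal_distribution_def by (subst emeasure_density) simp_all
  \<comment> \<open>The slope \<open>- s\<close> standardizes and reflects at once, so the upper
    tail becomes a lower tail, which is what a cdf measures.\<close>
  also have "\<dots> = ennreal s * (\<integral>\<^sup>+x. ennreal (normal_density m s (m + - s * x)) *
      indicator {c..} (m + - s * x) \<partial>lborel)"
    using assms by (subst nn_integral_real_affine[where c = "- s" and t = m]) simp_all
  also have "\<dots> = (\<integral>\<^sup>+x. ennreal s * (ennreal (normal_density m s (m + - s * x)) *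
      indicator {c..} (m + - s * x)) \<partial>lborel)"
    by (simp add: nn_integral_cmult)
  also have "\<dots> = (\<integral>\<^sup>+x. ennreal (std_normal_density x) * indicator {..(m - c) / s} x \<partial>lborel)"
  proof (rule nn_integral_cong)
    fix x :: real
    have "s * normal_density m s (m + - s * x) = std_normal_density x"
      using assms by (simp add: normal_density_def real_sqrt_mult power_mult_distrib)
    moreover have "indicator {c..} (m + - s * x) = (indicator {..(m - c) / s} x :: ennreal)"
      using assms by (auto simp: indicator_def field_simps)
    ultimately show "ennreal s * (ennreal (normal_density m s (m + - s * x)) *
        indicator {c..} (m + - s * x)) = ennreal (std_normal_density x) * indicator {..(m - c) / s} x"
      using assms by (metis ennreal_mult' less_imp_le mult.assoc)
  qed
  also have "\<dots> = emeasure std_normal_distribution {..(m - c) / s}"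
    by (subst emeasure_density) simp_all
  also have "\<dots> = ennreal (Phi ((m - c) / s))"
    by (simp add: Phi_def cdf_def emeasure_eq_measure)
  finally show ?thesis .
qed

lemma
  assumes "s_theta > 0" "s_eps > 0"
  shows total_sd_pos: "total_sd s_theta s_eps > 0"
    and posterior_sd_pos: "posterior_sd s_theta s_eps > 0"
    and tau_nonneg: "tau s_theta s_eps \<ge> 0"
  using assms by (simp_all add: total_sd_def posterior_sd_def tau_def add_pos_pos)

text \<open>Here \<open>a\<close> and \<open>b\<close> are the variances of prior and noise. With
  \<open>X = v - \<theta>\<close> and \<open>Y = v - x\<close>, everything rests on
  \<open>(b X + a Y)^2 = (a + b) (b X^2 + a Y^2) - a b (X - Y)^2\<close>, where
  \<open>X - Y = x - \<theta>\<close>.\<close>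

lemma prior_likelihood_complete_square:
  fixes a b \<theta> v x :: real
  assumes "a > 0" "b > 0"
  shows "- (v - \<theta>)\<^sup>2 / (2 * a) + - (x - v)\<^sup>2 / (2 * b) =
    - (x - \<theta>)\<^sup>2 / (2 * (a + b)) +
    - (v - (a / (b + a) * x + (1 - a / (b + a)) * \<theta>))\<^sup>2 / (2 * (b * a / (b + a)))"
proof -
  define k where "k = b + a"
  have nz: "k \<noteq> 0" "a \<noteq> 0" "b \<noteq> 0" using assms by (simp_all add: k_def)
  have a: "a = k - b" by (simp add: k_def)
  have d: "v - (a / k * x + (1 - a / k) * \<theta>) = (b * (v - \<theta>) + a * (v - x)) / k"
    using nz(1) by (simp add: a field_simps)
  have "(b * (v - \<theta>) + a * (v - x))\<^sup>2 = k * (b * (v - \<theta>)\<^sup>2 + a * (x - v)\<^sup>2) - a * b * (x - \<theta>)\<^sup>2"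
    unfolding k_def by (simp add: power2_eq_square algebra_simps)
  then have e: "(v - (a / k * x + (1 - a / k) * \<theta>))\<^sup>2 =
      (k * (b * (v - \<theta>)\<^sup>2 + a * (x - v)\<^sup>2) - a * b * (x - \<theta>)\<^sup>2) / k\<^sup>2"
    unfolding d power_divide by simp
  \<comment> \<open>The claim is now linear in the three squares. Replacing them by arbitrary
    \<open>A\<close>, \<open>B\<close>, \<open>C\<close> leaves a rational identity in
    \<open>a\<close>, \<open>b\<close>, \<open>k\<close> and keeps the squares from being
    expanded.\<close>
  have "- A / (2 * a) + - B / (2 * b) =
      - C / (2 * k) + - ((k * (b * A + a * B) - a * b * C) / k\<^sup>2) / (2 * (b * a / k))" for A B C
    using nz by (simp add: field_simps power2_eq_square)
  then show ?thesis
    unfolding add.commute[of a b] k_def[symmetric] e .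
qed

text \<open>Bayes' rule for densities: the joint density of quality \<open>v\<close> and valuation
  \<open>x\<close>, factored in both orders. The exponents agree by completing the square, the
  normalizing constants because both pairs of variances have the same product.\<close>

lemma prior_likelihood_eq_marginal_posterior:
  assumes "s_theta > 0" "s_eps > 0"
  shows "normal_density \<theta> s_theta v * normal_density v s_eps x =
    normal_density \<theta> (total_sd s_theta s_eps) x *
    normal_density (tau s_theta s_eps * x + (1 - tau s_theta s_eps) * \<theta>) (posterior_sd s_theta s_eps) v"
proof -
  let ?a = "s_theta\<^sup>2" and ?b = "s_eps\<^sup>2"
  have pos: "?a > 0" "?b > 0" "?a + ?b > 0" "?b + ?a > 0"
    using assms by (simp_all add: add_pos_pos)
  have vars: "(total_sd s_theta s_eps)\<^sup>2 = ?a + ?b"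
    "(posterior_sd s_theta s_eps)\<^sup>2 = ?b * ?a / (?b + ?a)"
    using pos by (simp_all add: total_sd_def posterior_sd_def)
  have const: "sqrt (2 * pi * ?a) * sqrt (2 * pi * ?b) =
      sqrt (2 * pi * (?a + ?b)) * sqrt (2 * pi * (?b * ?a / (?b + ?a)))"
    using pos unfolding real_sqrt_mult[symmetric]
    by (intro arg_cong[where f = sqrt]) (simp add: field_simps)
  have "normal_density \<theta> s_theta v * normal_density v s_eps x =
      1 / (sqrt (2 * pi * ?a) * sqrt (2 * pi * ?b)) *
      exp (- (v - \<theta>)\<^sup>2 / (2 * ?a) + - (x - v)\<^sup>2 / (2 * ?b))"
    unfolding exp_add by (simp add: normal_density_def)
  also have "\<dots> = normal_density \<theta> (total_sd s_theta s_eps) x *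
      normal_density (tau s_theta s_eps * x + (1 - tau s_theta s_eps) * \<theta>) (posterior_sd s_theta s_eps) v"
    unfolding const prior_likelihood_complete_square[OF pos(1,2)] exp_add
    by (simp add: normal_density_def vars tau_def)
  finally show ?thesis .
qed

text \<open>Both sides are the expectation of \<open>f v\<close> on the event that the valuation is
  at least \<open>c\<close>, conditioned first on the quality on the left and first on the valuation
  on the right.\<close>

lemma nn_integral_prior_Phi:
  assumes "s_theta > 0" "s_eps > 0"
    and [measurable]: "f \<in> borel_measurable borel"
  shows "(\<integral>\<^sup>+v. f v * ennreal (Phi ((v - c) / s_eps)) \<partial>prior \<theta> s_theta) =
    (\<integral>\<^sup>+x. (\<integral>\<^sup>+v. f v \<partial>posterior \<theta> s_theta s_eps x) * indicator {c..} x
      \<partial>normal_distribution \<theta> (total_sd s_theta s_eps))"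
proof -
  let ?M = "\<lambda>x. ennreal (normal_density \<theta> (total_sd s_theta s_eps) x)"
  let ?m = "\<lambda>x. tau s_theta s_eps * x + (1 - tau s_theta s_eps) * \<theta>"
  let ?P = "\<lambda>x v. ennreal (normal_density (?m x) (posterior_sd s_theta s_eps) v)"
  \<comment> \<open>Joint measurability makes the inner integral over \<open>v\<close> a measurable
    function of the valuation \<open>x\<close>.\<close>
  have [measurable]: "(\<lambda>(x, v). ?P x v) \<in> borel_measurable (lborel \<Otimes>\<^sub>M lborel)"
    by (simp add: normal_density_def)
  have "(\<integral>\<^sup>+v. f v * ennreal (Phi ((v - c) / s_eps)) \<partial>prior \<theta> s_theta) =
      (\<integral>\<^sup>+v. ennreal (normal_density \<theta> s_theta v) *
        (f v * emeasure (normal_distribution v s_eps) {c..}) \<partial>lborel)"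
    unfolding prior_def using assms(2)
    by (subst nn_integral_normal_distribution) (simp_all add: emeasure_normal_distribution_atLeast)
  also have "\<dots> = (\<integral>\<^sup>+v. (\<integral>\<^sup>+x. ennreal (normal_density \<theta> s_theta v) * f v *
      (ennreal (normal_density v s_eps x) * indicator {c..} x) \<partial>lborel) \<partial>lborel)"
    unfolding normal_distribution_def
    by (simp add: emeasure_density nn_integral_cmult mult.assoc)
  also have "\<dots> = (\<integral>\<^sup>+x. (\<integral>\<^sup>+v. ennreal (normal_density \<theta> s_theta v) * f v *
      (ennreal (normal_density v s_eps x) * indicator {c..} x) \<partial>lborel) \<partial>lborel)"
    by (rule lborel_pair.Fubini') (simp add: normal_density_def split_beta')
  also have "\<dots> = (\<integral>\<^sup>+x. (\<integral>\<^sup>+v. ?M x * indicator {c..} x * (?P x v * f v) \<partial>lborel) \<partial>lborel)"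
  proof (intro nn_integral_cong)
    fix x v :: real
    let ?A = "ennreal (normal_density \<theta> s_theta v)" and ?B = "ennreal (normal_density v s_eps x)"
    have AB: "?A * ?B = ?M x * ?P x v"
      by (simp add: ennreal_mult[symmetric] prior_likelihood_eq_marginal_posterior[OF assms(1,2)])
    have "?A * f v * (?B * indicator {c..} x) = ?A * ?B * (f v * indicator {c..} x)"
      by (simp only: mult_ac)
    then show "?A * f v * (?B * indicator {c..} x) = ?M x * indicator {c..} x * (?P x v * f v)"
      unfolding AB by (simp only: mult_ac)
  qed
  also have "\<dots> = (\<integral>\<^sup>+x. ?M x * ((\<integral>\<^sup>+v. f v \<partial>posterior \<theta> s_theta s_eps x) * indicator {c..} x) \<partial>lborel)"
    unfolding posterior_def
    by (intro nn_integral_cong, subst nn_integral_cmult) (simp_all add: nn_integral_normal_distribution mult_ac)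
  also have "\<dots> = (\<integral>\<^sup>+x. (\<integral>\<^sup>+v. f v \<partial>posterior \<theta> s_theta s_eps x) * indicator {c..} x
      \<partial>normal_distribution \<theta> (total_sd s_theta s_eps))"
    unfolding posterior_def
    by (subst nn_integral_normal_distribution) (simp_all add: nn_integral_normal_distribution)
  finally show ?thesis .
qed

text \<open>The bound \<open>0 \<le> c\<close> lets the cutoff be read as a price; it holds because
  \<open>c\<close> is the expected value of a nonnegative margin.\<close>

lemma reward_profit_le_no_reward_profit_at_cutoff:
  assumes pos: "s_theta > 0" "s_eps > 0"
    and r: "increasing_reward_program p r"
    and eq: "threshold_equilibrium \<theta> s_theta s_eps p r c"
  shows "0 \<le> c" and "reward_profit \<theta> s_theta s_eps p r c \<le> no_reward_profit \<theta> s_theta s_eps c"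
proof -
  \<comment> \<open>The seller's margin per sale; it is nonnegative because the rebate is at most
    \<open>p\<close>, so nonnegative integrals apply.\<close>
  define g where "g v = p - r v" for v
  have "mono r" and r_range: "0 \<le> r v" "r v \<le> p" for v
    using r by (auto simp: increasing_reward_program_def)
  have [measurable]: "r \<in> borel_measurable borel"
    using \<open>mono r\<close> by (rule borel_measurable_mono)
  have g_meas [measurable]: "g \<in> borel_measurable borel"
    unfolding g_def by measurable
  have g_nonneg: "0 \<le> g v" for v
    using r_range by (simp add: g_def)
  interpret post: prob_space "posterior \<theta> s_theta s_eps c"
    unfolding posterior_def using posterior_sd_pos[OF pos] by (rule prob_space_normal_distribution)
  have [measurable_cong]: "sets (posterior \<theta> s_theta s_eps c) = sets borel"
    by (simp add: posterior_def)
  have int: "integrable (posterior \<theta> s_theta s_eps c) r"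
    using r_range by (intro post.integrable_const_bound[where B = p]) auto
  have int_g: "integrable (posterior \<theta> s_theta s_eps c) g"
    unfolding g_def using int by simp
  \<comment> \<open>The valuation \<open>c\<close> falls under both halves of the equilibrium
    condition.\<close>
  have "buyer_payoff \<theta> s_theta s_eps p r c = 0"
    using eq by (auto simp: threshold_equilibrium_def intro: antisym)
  then have margin: "(\<integral>v. g v \<partial>posterior \<theta> s_theta s_eps c) = c"
    unfolding g_def using int by (simp add: buyer_payoff_def post.prob_space)
  then show "0 \<le> c"
    using g_nonneg by (metis Bochner_Integration.integral_nonneg)
  have margin_c: "(\<integral>\<^sup>+v. ennreal (g v) \<partial>posterior \<theta> s_theta s_eps c) = ennreal c"
    using nn_integral_eq_integral[OF int_g] g_nonneg margin by simp
  have margin_le: "(\<integral>\<^sup>+v. ennreal (g v) \<partial>posterior \<theta> s_theta s_eps x) \<le> ennreal c" if "c \<le> x" for x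
    unfolding margin_c[symmetric] unfolding posterior_def
  proof (rule nn_integral_normal_distribution_antimono_mean)
    show "antimono (\<lambda>v. ennreal (g v))"
      using \<open>mono r\<close> by (auto simp: g_def antimono_def mono_def intro!: ennreal_leI)
    show "tau s_theta s_eps * c + (1 - tau s_theta s_eps) * \<theta> \<le>
        tau s_theta s_eps * x + (1 - tau s_theta s_eps) * \<theta>"
      using that tau_nonneg[OF pos] by (simp add: mult_left_mono)
  qed simp
  have "(\<integral>\<^sup>+v. ennreal (g v * Phi ((v - c) / s_eps)) \<partial>prior \<theta> s_theta) =
      (\<integral>\<^sup>+v. ennreal (g v) * ennreal (Phi ((v - c) / s_eps)) \<partial>prior \<theta> s_theta)"
    by (intro nn_integral_cong ennreal_mult g_nonneg Phi_nonneg)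
  also have "\<dots> = (\<integral>\<^sup>+x. (\<integral>\<^sup>+v. ennreal (g v) \<partial>posterior \<theta> s_theta s_eps x) * indicator {c..} x
      \<partial>normal_distribution \<theta> (total_sd s_theta s_eps))"
    by (rule nn_integral_prior_Phi[OF pos]) simp
  \<comment> \<open>Only valuations \<open>x \<ge> c\<close> count here, and for these the expected
    margin is at most \<open>c\<close> by \<open>margin_le\<close>.\<close>
  also have "\<dots> \<le> (\<integral>\<^sup>+x. ennreal c * indicator {c..} x \<partial>normal_distribution \<theta> (total_sd s_theta s_eps))"
    by (intro nn_integral_mono) (auto simp: indicator_def intro: margin_le)
  also have "\<dots> = ennreal c * ennreal (Phi ((\<theta> - c) / total_sd s_theta s_eps))"
    using emeasure_normal_distribution_atLeast[OF total_sd_pos[OF pos]]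
    by (simp add: nn_integral_cmult_indicator)
  also have "\<dots> = ennreal (no_reward_profit \<theta> s_theta s_eps c)"
    using \<open>0 \<le> c\<close> unfolding no_reward_profit_def by (rule ennreal_mult[symmetric, OF _ Phi_nonneg])
  finally have bound: "(\<integral>\<^sup>+v. ennreal (g v * Phi ((v - c) / s_eps)) \<partial>prior \<theta> s_theta)
      \<le> ennreal (no_reward_profit \<theta> s_theta s_eps c)" .
  have "reward_profit \<theta> s_theta s_eps p r c = (\<integral>v. g v * Phi ((v - c) / s_eps) \<partial>prior \<theta> s_theta)"
    by (simp only: reward_profit_def g_def)
  \<comment> \<open>The bound was proved for the nonnegative integral; since it is finite and the
    integrand nonnegative, it passes to the Bochner integral.\<close>
  also have "\<dots> = enn2real (\<integral>\<^sup>+v. ennreal (g v * Phi ((v - c) / s_eps)) \<partial>prior \<theta> s_theta)"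
  proof (rule integral_eq_nn_integral)
    show "(\<lambda>v. g v * Phi ((v - c) / s_eps)) \<in> borel_measurable (prior \<theta> s_theta)"
      unfolding prior_def by measurable
    show "AE v in prior \<theta> s_theta. 0 \<le> g v * Phi ((v - c) / s_eps)"
      by (intro AE_I2 mult_nonneg_nonneg g_nonneg Phi_nonneg)
  qed
  also have "\<dots> \<le> no_reward_profit \<theta> s_theta s_eps c"
  proof (rule enn2real_leI[OF _ bound])
    show "0 \<le> no_reward_profit \<theta> s_theta s_eps c"
      unfolding no_reward_profit_def using \<open>0 \<le> c\<close> by (rule mult_nonneg_nonneg[OF _ Phi_nonneg])
  qed
  finally show "reward_profit \<theta> s_theta s_eps p r c \<le> no_reward_profit \<theta> s_theta s_eps c" .
qed

theorem theorem2:
  fixes \<theta> s_theta s_eps p :: real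
  assumes "s_theta > 0" and "s_eps > 0"
    and "market_price \<theta> s_theta s_eps p"
  shows "\<not> (\<exists>(r :: real \<Rightarrow> real) (c :: real).
    increasing_reward_program p r \<and>
    threshold_equilibrium \<theta> s_theta s_eps p r c \<and>
    reward_profit \<theta> s_theta s_eps p r c > no_reward_profit \<theta> s_theta s_eps p)"
proof -
  have "reward_profit \<theta> s_theta s_eps p r c \<le> no_reward_profit \<theta> s_theta s_eps p"
    if "increasing_reward_program p r" "threshold_equilibrium \<theta> s_theta s_eps p r c" for r c
  proof -
    note c = reward_profit_le_no_reward_profit_at_cutoff[OF assms(1,2) that]
    have "no_reward_profit \<theta> s_theta s_eps c \<le> no_reward_profit \<theta> s_theta s_eps p"
    \<comment> \<open>\<open>market_price\<close> compares only with prices \<open>q > 0\<close>. At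
      cutoff 0 the no-reward profit is 0, which the nonnegative profit at \<open>p\<close> matches
      or exceeds.\<close>
    proof (cases "c = 0")
      case True
      then show ?thesis
        using assms(3) by (simp add: market_price_def no_reward_profit_def Phi_nonneg)
    next
      case False
      then show ?thesis
        using assms(3) c(1) by (simp add: market_price_def)
    qed
    with c(2) show ?thesis
      by linarith
  qed
  then show ?thesis
    by (meson not_le)
qed

end
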